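(* Let $h \geq 2$. Let $M(h)$ be the set of all pairs $(s,t)$ such that \[ s = \liminf_{n\to\infty} g_{\mathcal{B}}(n) \quad\text{and}\quad t = \limsup_{n\to\infty} g_{\mathcal{B}}(n) \] for some asymptotic multiplicative system $\mathcal{B}$ of order $h$. Then \[ M(h) = \{(1,t) : t \in \mathbb{N} \cup \{\infty\}\} \cup \{(s,\infty) : s \in \{2,\ldots,h\}\}. \]
   Context: $\mathbb{N} = \{1,2,3,\ldots\}$. For $h \geq 2$ and an $h$-tuple $\mathcal{B} = (B_1,\ldots,B_h)$ of sets of positive integers, define $g_{\mathcal{B}}(n) = \#\{(b_1,\ldots,b_h) \in B_1 \times \cdots \times B_h : b_1 \cdots b_h = n\}$. The tuple $\mathcal{B}$ is an asymptotic multiplicative system of order $h$ if $g_{\mathcal{B}}(n) \geq 1$ for all sufficiently large integers $n$. Limits inferior and superior take values in $\mathbb{N}_0 \cup \{\infty\}$. *)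

theory Defs
  imports Main "HOL-Library.FuncSet" "HOL-Library.Extended_Nat" "HOL-Library.Liminf_Limsup"
begin

text \<open>
  A tuple of sets \<open>(B 1, ..., B h)\<close> is a function on indices of which only the values at
  \<open>{1..h}\<close> matter. Its representations of \<open>n\<close> are the extensional functions on \<open>{1..h}\<close> below.
  When all \<open>B i\<close> consist of positive integers there are only finitely many of them, so \<open>card\<close>
  is the true number of representations.
\<close>

definition rep_count :: "nat \<Rightarrow> (nat \<Rightarrow> nat set) \<Rightarrow> nat \<Rightarrow> nat" where
  "rep_count h B n = card {b \<in> Pi\<^sub>E {1..h} B. (\<Prod>i\<in>{1..h}. b i) = n}"

definition asymptotic_multiplicative_system :: "nat \<Rightarrow> (nat \<Rightarrow> nat set) \<Rightarrow> bool" where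
  "asymptotic_multiplicative_system h B \<longleftrightarrow>
     (\<forall>i\<in>{1..h}. \<forall>b\<in>B i. b \<ge> 1) \<and> (\<forall>\<^sub>F n in sequentially. rep_count h B n \<ge> 1)"

definition limit_pairs :: "nat \<Rightarrow> (enat \<times> enat) set" where
  "limit_pairs h =
     {(s, t). \<exists>B. asymptotic_multiplicative_system h B \<and>
        s = liminf (\<lambda>n. enat (rep_count h B n)) \<and>
        t = limsup (\<lambda>n. enat (rep_count h B n))}"

end

theory Submission
  imports Defs "HOL-Library.Ramsey" "HOL-Computational_Algebra.Primes"
begin

text \<open>
  A prime \<open>p\<close> has at most one representation for each index \<open>i\<close> with \<open>p \<in> B i\<close>, so the limit
  inferior is at most \<open>h\<close>. If it is at least 2, then every large prime lies in two of the sets, and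
  all the sets contain 1. Ramsey's theorem yields infinitely many primes such that, up to any given
  size, membership of a product of distinct ones in \<open>B i\<close> depends only on the number of factors.
  A representation of such a product with at least two nontrivial factors can then be permuted, which
  gives many representations. If the only representation puts everything into a single factor,
  adjoin one more prime to a different factor.

  Conversely, all positive integers together with \<open>{2 ^ k | k < t}\<close> give \<open>(1, t)\<close>, and \<open>s\<close>
  copies of the set of positive integers give \<open>(s, \<infinity>)\<close>; the remaining sets are \<open>{1}\<close>.
\<close>

subsection \<open>Representations\<close>

text \<open>Names the set counted by \<open>rep_count\<close>, because the counting arguments below
  compare such sets through maps between them.\<close>

definition reps :: "nat \<Rightarrow> (nat \<Rightarrow> nat set) \<Rightarrow> nat \<Rightarrow> (nat \<Rightarrow> nat) set" where
  "reps h B n = {b \<in> Pi\<^sub>E {1..h} B. (\<Prod>i\<in>{1..h}. b i) = n}"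

lemma rep_count_eq_card_reps: "rep_count h B n = card (reps h B n)"
  by (simp add: rep_count_def reps_def)

text \<open>Every factor divides \<open>n > 0\<close> and is therefore at most \<open>n\<close>, so
  all representations lie in a finite box. Without finiteness \<open>card\<close> would be 0 and
  lower bounds would fail.\<close>

lemma finite_reps:
  assumes "n > 0"
  shows "finite (reps h B n)"
proof (rule finite_subset)
  show "reps h B n \<subseteq> Pi\<^sub>E {1..h} (\<lambda>_. {..n})"
  proof
    fix b assume b: "b \<in> reps h B n"
    have "b i \<le> n" if "i \<in> {1..h}" for i
    proof -
      have "b i dvd (\<Prod>i\<in>{1..h}. b i)" using that by (intro dvd_prodI) auto
      then show ?thesis using b assms by (auto simp: reps_def intro: dvd_imp_le)
    qed
    then show "b \<in> Pi\<^sub>E {1..h} (\<lambda>_. {..n})" using b by (auto simp: reps_def PiE_iff)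
  qed
qed (simp add: finite_PiE)

text \<open>The trivial factorizations of \<open>n\<close>. The restriction to \<open>{1..h}\<close>
  makes them extensional, as membership in \<open>Pi\<^sub>E\<close> requires.\<close>

definition single :: "nat \<Rightarrow> nat \<Rightarrow> nat \<Rightarrow> nat \<Rightarrow> nat" where
  "single h n i = (\<lambda>j\<in>{1..h}. if j = i then n else 1)"

lemma prod_single: "i \<in> {1..h} \<Longrightarrow> (\<Prod>j\<in>{1..h}. single h n i j) = n"
  by (simp add: single_def)

section \<open>Representations of a prime\<close>

text \<open>The prime divides some factor, which must then equal \<open>p\<close> and forces all the
  others to be 1. Only an inclusion holds, since the other sets might not contain 1.\<close>

lemma reps_prime:
  assumes "prime p"
  shows "reps h B p \<subseteq> single h p ` {i\<in>{1..h}. p \<in> B i}"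
proof
  fix b assume b: "b \<in> reps h B p"
  then have bp: "(\<Prod>i\<in>{1..h}. b i) = p" and bB: "b \<in> Pi\<^sub>E {1..h} B" by (auto simp: reps_def)
  have "p dvd (\<Prod>i\<in>{1..h}. b i)" using bp by simp
  then obtain i where i: "i \<in> {1..h}" "p dvd b i"
    using assms by (auto simp: prime_dvd_prod_iff)
  have split: "b i * (\<Prod>j\<in>{1..h}-{i}. b j) = p"
    using bp i(1) by (metis finite_atLeastAtMost prod.remove)
  then have "b i dvd p" by (metis dvd_triv_left)
  then have bi: "b i = p" using i(2) by (simp add: dvd_antisym)
  then have "(\<Prod>j\<in>{1..h}-{i}. b j) = 1" using split prime_gt_0_nat[OF assms] by simp
  then have "b j = 1" if "j \<in> {1..h}" "j \<noteq> i" for j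
    using that prod_eq_1_iff[of "{1..h}-{i}" b] by simp
  then have "b = single h p i"
    using bi bB i by (auto simp: single_def fun_eq_iff PiE_iff extensional_def)
  moreover have "p \<in> B i" using bB i bi by (auto simp: PiE_iff)
  ultimately show "b \<in> single h p ` {i\<in>{1..h}. p \<in> B i}" using i by auto
qed

lemma rep_count_prime_le:
  assumes "prime p"
  shows "rep_count h B p \<le> card {i\<in>{1..h}. p \<in> B i}"
  unfolding rep_count_eq_card_reps
  by (rule surj_card_le[OF _ reps_prime[OF assms]]) simp

text \<open>One of the two representations differs from \<open>single h p k\<close>; it places
  \<open>p\<close> at another index and so has entry 1 at \<open>k\<close>. This later allows an
  index to receive the empty product.\<close>

lemma one_mem_of_rep_count_prime:
  assumes "prime p" "rep_count h B p \<ge> 2" "k \<in> {1..h}"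
  shows "1 \<in> B k"
proof -
  have "card (reps h B p - {single h p k}) \<noteq> 0"
    using assms(2) by (auto simp: rep_count_eq_card_reps card_Diff_singleton_if)
  then obtain b where b: "b \<in> reps h B p" "b \<noteq> single h p k"
    by (metis Diff_iff card.empty equals0I singletonI)
  then obtain i where "b = single h p i" using reps_prime[OF assms(1)] by blast
  then have "b k = 1" using b assms(3) by (auto simp: single_def)
  moreover have "b k \<in> B k" using b assms(3) by (auto simp: reps_def PiE_iff)
  ultimately show ?thesis by simp
qed

section \<open>Factorizations of products of distinct primes as colourings\<close>

text \<open>Unique factorization: each prime goes into exactly one factor, and colouring it by the
  index of that factor recovers the factorization. Empty colour classes correspond to factors
  1.\<close>

lemma rep_of_prod_primes:
  fixes b :: "'i \<Rightarrow> nat"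
  assumes "finite X" "finite I" "\<forall>p\<in>X. prime p" "(\<Prod>i\<in>I. b i) = \<Prod>X"
  obtains c where "c \<in> X \<rightarrow> I" "\<And>i. i \<in> I \<Longrightarrow> b i = \<Prod>{p\<in>X. c p = i}"
proof -
  from assms(1,3,4) have "\<exists>c. c \<in> X \<rightarrow> I \<and> (\<forall>i\<in>I. b i = \<Prod>{p\<in>X. c p = i})"
  proof (induction X arbitrary: b rule: finite_induct)
    case empty
    then show ?case using assms(2) prod_eq_1_iff[of I b] by simp
  next
    case (insert p X)
    have p: "prime p" using insert.prems by simp
    have "p dvd (\<Prod>i\<in>I. b i)" using insert by simp
    then obtain k where k: "k \<in> I" "p dvd b k" using p assms(2) by (auto simp: prime_dvd_prod_iff)
    then obtain q where q: "b k = p * q" by (auto elim: dvdE)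
    \<comment> \<open>Cancelling \<open>p\<close> from the factor that it divides leaves a
      factorization of the product over \<open>X\<close>, to which the induction hypothesis
      applies.\<close>
    let ?b = "b(k := q)"
    have "p * (\<Prod>i\<in>I. ?b i) = p * (q * (\<Prod>i\<in>I-{k}. ?b i))"
      using k assms(2) by (simp add: prod.remove[of I k])
    also have "(\<Prod>i\<in>I-{k}. ?b i) = (\<Prod>i\<in>I-{k}. b i)" by (rule prod.cong) auto
    also have "p * (q * (\<Prod>i\<in>I-{k}. b i)) = (\<Prod>i\<in>I. b i)"
      using k q assms(2) by (simp add: prod.remove[of I k])
    also have "\<dots> = p * \<Prod>X" using insert by simp
    finally have "(\<Prod>i\<in>I. ?b i) = \<Prod>X" using prime_gt_0_nat[OF p] by simp
    with insert.IH[of ?b] insert.prems obtain c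
      where c: "c \<in> X \<rightarrow> I" "\<forall>i\<in>I. ?b i = \<Prod>{p\<in>X. c p = i}" by auto
    let ?c = "c(p := k)"
    have "b i = \<Prod>{x\<in>insert p X. ?c x = i}" if i: "i \<in> I" for i
    proof (cases "i = k")
      case True
      then have "{x\<in>insert p X. ?c x = i} = insert p {x\<in>X. c x = k}" using insert by auto
      moreover have "q = \<Prod>{x\<in>X. c x = k}" using c(2) k(1) by auto
      ultimately show ?thesis using True q insert by simp
    next
      case False
      then have "{x\<in>insert p X. ?c x = i} = {x\<in>X. c x = i}" using insert by auto
      moreover have "b i = \<Prod>{x\<in>X. c x = i}" using c(2) i False by auto
      ultimately show ?thesis by simp
    qed
    moreover have "?c \<in> insert p X \<rightarrow> I" using c(1) k(1) by auto
    ultimately show ?case by blast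
  qed
  then show ?thesis using that by blast
qed

subsection \<open>Unboundedness\<close>

text \<open>Ramsey's theorem is applied to one \<open>t\<close> at a time, passing each time to an
  infinite subset; the homogeneity already obtained is inherited by subsets. The sizes
  \<open>r t\<close> may differ.\<close>

lemma ramsey_finite_family:
  fixes P :: "'t \<Rightarrow> 'a set \<Rightarrow> bool" and r :: "'t \<Rightarrow> nat"
  assumes "finite T" "infinite Z"
  obtains Y where "Y \<subseteq> Z" "infinite Y"
    "\<And>t X X'. \<lbrakk>t \<in> T; X \<subseteq> Y; finite X; card X = r t; X' \<subseteq> Y; finite X'; card X' = r t; P t X\<rbrakk>
      \<Longrightarrow> P t X'"
proof -
  from assms(1) have "\<exists>Y. Y \<subseteq> Z \<and> infinite Y \<and> (\<forall>t\<in>T. \<forall>X X'. X \<subseteq> Y \<and> finite X \<and> card X = r t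
     \<and> X' \<subseteq> Y \<and> finite X' \<and> card X' = r t \<and> P t X \<longrightarrow> P t X')"
  proof (induction T rule: finite_induct)
    case empty
    then show ?case using assms(2) by auto
  next
    case (insert t T)
    then obtain Y where Y: "Y \<subseteq> Z" "infinite Y" "\<forall>t\<in>T. \<forall>X X'. X \<subseteq> Y \<and> finite X \<and> card X = r t
       \<and> X' \<subseteq> Y \<and> finite X' \<and> card X' = r t \<and> P t X \<longrightarrow> P t X'" by blast
    \<comment> \<open>The truth value of \<open>P t\<close> serves as a 2-colouring of the sets of
      size \<open>r t\<close>.\<close>
    have "of_bool (P t X) < (2::nat)" for X by simp
    then obtain W v where W: "W \<subseteq> Y" "infinite W"
      "\<forall>X. X \<subseteq> W \<and> finite X \<and> card X = r t \<longrightarrow> of_bool (P t X) = (v::nat)"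
      using Ramsey[OF Y(2), of "r t" "\<lambda>X. of_bool (P t X)" 2] by blast
    then have "P t X \<longrightarrow> P t X'" if "X \<subseteq> W \<and> finite X \<and> card X = r t"
      "X' \<subseteq> W \<and> finite X' \<and> card X' = r t" for X X'
      using that by (metis of_bool_eq_iff)
    moreover have "X \<subseteq> Y" if "X \<subseteq> W" for X using that W(1) by simp
    ultimately have "W \<subseteq> Z \<and> infinite W \<and> (\<forall>t\<in>insert t T. \<forall>X X'. X \<subseteq> W \<and> finite X \<and> card X = r t
       \<and> X' \<subseteq> W \<and> finite X' \<and> card X' = r t \<and> P t X \<longrightarrow> P t X')"
      using W Y by (metis insert_iff subset_trans)
    then show ?case by blast
  qed
  then show ?thesis using that by metis
qed

section \<open>Many representations from prescribed class sizes\<close>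

text \<open>Greedy: cut off a subset of size \<open>r k\<close> for one index and distribute the
  remainder among the others.\<close>

lemma exists_colouring_with_sizes:
  fixes r :: "'i \<Rightarrow> nat"
  assumes "finite I" "finite X" "sum r I = card X"
  obtains c where "c \<in> X \<rightarrow> I" "\<And>i. i \<in> I \<Longrightarrow> card {x\<in>X. c x = i} = r i"
proof -
  from assms have "\<exists>c. c \<in> X \<rightarrow> I \<and> (\<forall>i\<in>I. card {x\<in>X. c x = i} = r i)"
  proof (induction I arbitrary: X rule: finite_induct)
    case empty
    then show ?case by simp
  next
    case (insert k I)
    then have "r k \<le> card X" by simp
    then obtain S where S: "S \<subseteq> X" "card S = r k" "finite S" by (rule obtain_subset_with_card_n)
    then have "sum r I = card (X - S)" using insert by (simp add: card_Diff_subset)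
    with insert.IH[of "X - S"] insert.prems obtain c
      where c: "c \<in> X - S \<rightarrow> I" "\<forall>i\<in>I. card {x\<in>X-S. c x = i} = r i" by auto
    let ?c = "\<lambda>x. if x \<in> S then k else c x"
    have k: "{x\<in>X. ?c x = k} = S" using S(1) c(1) insert.hyps(2) by (auto simp: Pi_iff)
    have other: "{x\<in>X. ?c x = i} = {x\<in>X-S. c x = i}" if "i \<in> I" for i
      using that insert.hyps(2) by auto
    have "card {x\<in>X. ?c x = i} = r i" if "i \<in> insert k I" for i
    proof (cases "i = k")
      case True
      then show ?thesis using k S(2) by (simp only:)
    next
      case False
      then have "i \<in> I" using that by simp
      then show ?thesis using other c(2) by (simp only:)
    qed
    moreover have "?c \<in> X \<rightarrow> insert k I" using c(1) by (auto simp: Pi_iff)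
    ultimately show ?case by blast
  qed
  then show ?thesis using that by blast
qed

lemma prime_dvd_prod_primes_iff:
  fixes S :: "nat set"
  assumes "finite S" "\<forall>q\<in>S. prime q" "prime p"
  shows "p dvd \<Prod>S \<longleftrightarrow> p \<in> S"
  using assms by (auto simp: prime_dvd_prod_iff intro: dvd_refl dest: primes_dvd_imp_eq)

text \<open>Any \<open>S\<close> of size \<open>r a\<close> can be the set of primes in factor
  \<open>a\<close>, the rest being distributed by size, and \<open>S\<close> is recovered as the set
  of primes dividing that factor. This gives at least \<open>card X choose r a\<close>
  representations, which is at least \<open>card X\<close> because
  \<open>0 < r a < card X\<close>.\<close>

lemma rep_count_prod_primes_ge:
  assumes X: "finite X" "\<forall>p\<in>X. prime p"
    and r: "sum r {1..h} = card X" "a \<in> {1..h}" "0 < r a" "r a < card X"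
    and B: "\<And>i S. \<lbrakk>i \<in> {1..h}; S \<subseteq> X; card S = r i\<rbrakk> \<Longrightarrow> \<Prod>S \<in> B i"
  shows "card X \<le> rep_count h B (\<Prod>X)"
proof -
  let ?F = "\<lambda>b. {p\<in>X. p dvd b a}"
  have "{S. S \<subseteq> X \<and> card S = r a} \<subseteq> ?F ` reps h B (\<Prod>X)"
  proof
    fix S assume "S \<in> {S. S \<subseteq> X \<and> card S = r a}"
    then have S: "S \<subseteq> X" "card S = r a" by auto
    then have fS: "finite S" using X finite_subset by blast
    have "sum r ({1..h} - {a}) = card (X - S)"
      using r S fS by (simp add: card_Diff_subset sum.remove[of _ a])
    then obtain c where c: "c \<in> X - S \<rightarrow> {1..h} - {a}"
        "\<And>i. i \<in> {1..h} - {a} \<Longrightarrow> card {x\<in>X-S. c x = i} = r i"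
      using exists_colouring_with_sizes[of "{1..h} - {a}" "X - S" r] X by auto
    define b where "b = (\<lambda>i\<in>{1..h}. if i = a then \<Prod>S else \<Prod>{x\<in>X-S. c x = i})"
    have "(\<Prod>i\<in>{1..h}. b i) = \<Prod>S * (\<Prod>i\<in>{1..h}-{a}. \<Prod>{x\<in>X-S. c x = i})"
      using r(2) by (simp add: b_def prod.remove[of _ a])
    also have "(\<Prod>i\<in>{1..h}-{a}. \<Prod>{x\<in>X-S. c x = i}) = \<Prod>(X - S)"
      using c X by (intro prod.group) auto
    also have "\<Prod>S * \<Prod>(X - S) = \<Prod>X" using S X by (simp add: prod.subset_diff mult.commute)
    finally have "b \<in> reps h B (\<Prod>X)"
      using B S c(2) by (auto simp: reps_def b_def intro!: B)
    moreover have "?F b = S"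
      using S fS X r(2) by (auto simp: b_def prime_dvd_prod_primes_iff subset_iff)
    ultimately show "S \<in> ?F ` reps h B (\<Prod>X)" by blast
  qed
  moreover have "finite (reps h B (\<Prod>X))"
    using X by (intro finite_reps) (auto intro!: prod_pos prime_gt_0_nat)
  ultimately have "card {S. S \<subseteq> X \<and> card S = r a} \<le> rep_count h B (\<Prod>X)"
    unfolding rep_count_eq_card_reps by (rule surj_card_le[rotated])
  moreover have "card {S. S \<subseteq> X \<and> card S = r a} = card X choose r a"
    using n_subsets[OF X(1)] by simp
  ultimately show ?thesis using upper_le_binomial[OF r(3,4)] by simp
qed

section \<open>Unboundedness from two representations\<close>

lemma rep_count_unbounded:
  assumes "\<forall>n\<ge>N. rep_count h B n \<ge> 2"
  shows "\<exists>n\<ge>N. K < rep_count h B n"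
proof -
  let ?I = "{1..h}"
  define Z where "Z = {p. prime p \<and> p \<ge> N}"
  have infZ: "infinite Z"
    unfolding infinite_nat_iff_unbounded_le
  proof
    fix m
    obtain p where "prime p" "p > max N m" using bigger_prime by blast
    then show "\<exists>n\<ge>m. n \<in> Z" by (auto simp: Z_def intro!: exI[of _ p])
  qed
  \<comment> \<open>The family is indexed by pairs of a size and an index of the tuple. Sizes up to
    \<open>Suc K\<close> cover all classes used below, including the singletons.\<close>
  obtain Y where Y: "Y \<subseteq> Z" "infinite Y" and hom':
    "\<And>t X X'. \<lbrakk>t \<in> {..Suc K} \<times> ?I; X \<subseteq> Y; finite X; card X = fst t; X' \<subseteq> Y; finite X';
        card X' = fst t; \<Prod>X \<in> B (snd t)\<rbrakk> \<Longrightarrow> \<Prod>X' \<in> B (snd t)"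
    using ramsey_finite_family[of "{..Suc K} \<times> ?I" Z fst "\<lambda>t X. \<Prod>X \<in> B (snd t)"] infZ by auto
  have hom: "\<Prod>X' \<in> B i" if "i \<in> ?I" "X \<subseteq> Y" "finite X" "card X \<le> Suc K" "\<Prod>X \<in> B i"
    "X' \<subseteq> Y" "finite X'" "card X' = card X" for i X X'
    using hom'[of "(card X, i)" X X'] that by auto
  have prime: "prime p" if "p \<in> Y" for p using that Y by (auto simp: Z_def)
  have large: "N \<le> \<Prod>X" if "X \<subseteq> Y" "finite X" "X \<noteq> {}" for X
  proof -
    obtain p where p: "p \<in> X" using \<open>X \<noteq> {}\<close> by auto
    then have "p dvd \<Prod>X" using that dvd_prodI[of X p "\<lambda>x. x"] by simp
    moreover have "0 < \<Prod>X" using that prime by (auto intro!: prod_pos prime_gt_0_nat)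
    ultimately have "p \<le> \<Prod>X" by (rule dvd_imp_le)
    moreover have "N \<le> p" using p that(1) Y(1) by (auto simp: Z_def)
    ultimately show ?thesis by simp
  qed
  \<comment> \<open>With \<open>Suc K\<close> primes, the bound
    \<open>card X \<le> rep_count h B (\<Prod>X)\<close> already exceeds \<open>K\<close>.\<close>
  obtain X where X: "X \<subseteq> Y" "finite X" "card X = Suc K"
    using infinite_arbitrarily_large[OF Y(2)] by blast
  have X0: "X \<noteq> {}" using X by auto
  have "reps h B (\<Prod>X) \<noteq> {}"
    using assms large[OF X(1,2) X0] by (fastforce simp: rep_count_eq_card_reps)
  then obtain b where b: "b \<in> Pi\<^sub>E ?I B" "(\<Prod>i\<in>?I. b i) = \<Prod>X" by (auto simp: reps_def)
  then obtain c where c: "c \<in> X \<rightarrow> ?I" "\<And>i. i \<in> ?I \<Longrightarrow> b i = \<Prod>{p\<in>X. c p = i}"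
    using rep_of_prod_primes[of X ?I b] X prime by blast
  define r where "r i = card {p\<in>X. c p = i}" for i
  have r_sum: "sum r ?I = card X"
  proof -
    have "sum r ?I = (\<Sum>i\<in>?I. \<Sum>p\<in>{p\<in>X. c p = i}. 1)" by (simp add: r_def)
    also have "\<dots> = (\<Sum>p\<in>X. 1)" using c(1) X(2) by (intro sum.group) auto
    finally show ?thesis by simp
  qed
  have r_le: "r i \<le> Suc K" for i
    unfolding r_def X(3)[symmetric] using X by (intro card_mono) auto
  \<comment> \<open>The classes of one representation decide membership for all sets of the same
    sizes. \<open>S\<close> ranges over subsets of \<open>Y\<close>, not just of \<open>X\<close>,
    because a larger set of primes is needed in the second case.\<close>
  have rB: "\<Prod>S \<in> B i" if "i \<in> ?I" "S \<subseteq> Y" "finite S" "card S = r i" for i S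
  proof (rule hom[OF that(1) _ _ _ _ that(2,3)])
    show "\<Prod>{p\<in>X. c p = i} \<in> B i" using PiE_mem[OF b(1) that(1)] c(2)[OF that(1)] by simp
    show "card {p\<in>X. c p = i} \<le> Suc K" using r_le[of i] by (simp only: r_def)
    show "card S = card {p\<in>X. c p = i}" using that(4) by (simp only: r_def)
  qed (use X(1,2) in auto)
  obtain p0 where p0: "p0 \<in> X" using X0 by blast
  define a where "a = c p0"
  have a: "a \<in> ?I" using c(1) p0 by (auto simp: a_def)
  have ra: "0 < r a" using p0 X(2) by (auto simp: r_def a_def card_gt_0_iff)
  show ?thesis
  proof (cases "r a < Suc K")
    case True
    have "card X \<le> rep_count h B (\<Prod>X)"
    proof (rule rep_count_prod_primes_ge[OF X(2) _ r_sum a ra])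
      show "\<forall>p\<in>X. prime p" using X(1) prime by blast
      show "r a < card X" using True X(3) by simp
      show "\<Prod>S \<in> B i" if "i \<in> ?I" "S \<subseteq> X" "card S = r i" for i S
        using rB[OF that(1) _ _ that(3)] that(2) X(1,2) finite_subset by blast
    qed
    then have "K < rep_count h B (\<Prod>X)" using X(3) by simp
    then show ?thesis using large[OF X(1,2) X0] by blast
  next
    case False
    \<comment> \<open>Now all of \<open>X\<close> lies in factor \<open>a\<close>, and permuting
      primes yields nothing new. A second index \<open>j\<close> must take part.\<close>
    then have raK: "r a = Suc K" using r_le[of a] by simp
    have p0Y: "p0 \<in> Y" using p0 X(1) by blast
    then have two: "2 \<le> rep_count h B p0" using assms Y(1) by (auto simp: Z_def)
    then have "2 \<le> card {i\<in>?I. p0 \<in> B i}"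
      using rep_count_prime_le[OF prime[OF p0Y], of h B] by linarith
    then have "card ({i\<in>?I. p0 \<in> B i} - {a}) \<noteq> 0"
      by (simp add: card_Diff_singleton_if)
    then obtain j where j: "j \<in> ?I" "p0 \<in> B j" "j \<noteq> a"
      by (metis (no_types, lifting) Diff_iff card.empty equals0I mem_Collect_eq singletonI)
    obtain W where W: "W \<subseteq> Y" "finite W" "card W = Suc (Suc K)"
      using infinite_arbitrarily_large[OF Y(2)] by blast
    \<comment> \<open>Of the \<open>Suc (Suc K)\<close> primes in \<open>W\<close>, all but one go
      to \<open>a\<close> and one goes to \<open>j\<close>; the other factors are 1. No class
      exceeds \<open>Suc K\<close>, so homogeneity still applies, and \<open>r' a\<close> is now
      strictly below \<open>card W\<close>.\<close>
    define r' where "r' = (\<lambda>i. if i = a then Suc K else if i = j then 1 else 0)"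
    have "sum r' ?I = (\<Sum>i\<in>?I. (if i = a then Suc K else 0) + (if i = j then 1 else 0))"
      by (rule sum.cong) (simp_all add: r'_def j(3)[symmetric])
    then have r'_sum: "sum r' ?I = card W"
      using a j(1) W(3) by (simp add: sum.distrib)
    have r'B: "\<Prod>S \<in> B i" if i: "i \<in> ?I" and S: "S \<subseteq> W" "card S = r' i" for i S
    proof -
      have S': "S \<subseteq> Y" "finite S" using S(1) W(1,2) finite_subset by blast+
      consider "i = a" | "i = j" "i \<noteq> a" | "i \<noteq> a" "i \<noteq> j" by blast
      then show ?thesis
      proof cases
        case 1
        then show ?thesis using rB[OF i S'] S(2) raK by (simp add: r'_def)
      next
        case 2
        then show ?thesis using hom[of j "{p0}" S] S(2) S' j p0Y by (simp add: r'_def)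
      next
        case 3
        then have "S = {}" using S(2) S'(2) by (simp add: r'_def)
        then show ?thesis using one_mem_of_rep_count_prime[OF prime[OF p0Y] two i] by simp
      qed
    qed
    have "card W \<le> rep_count h B (\<Prod>W)"
    proof (rule rep_count_prod_primes_ge[OF W(2) _ r'_sum a _ _ r'B])
      show "\<forall>p\<in>W. prime p" using W(1) prime by blast
    qed (simp_all add: r'_def W(3))
    then have "K < rep_count h B (\<Prod>W)" using W(3) by simp
    moreover have "W \<noteq> {}" using W(3) by auto
    ultimately show ?thesis using large[OF W(1,2)] by blast
  qed
qed

subsection \<open>Constructions\<close>

lemma Liminf_le_frequently:
  fixes f :: "'a \<Rightarrow> 'b :: complete_linorder"
  assumes "\<exists>\<^sub>F x in F. f x \<le> c"
  shows "Liminf F f \<le> c"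
  using assms less_LiminfD[of c F f] by (auto simp: frequently_def not_le[symmetric])

lemma Limsup_ge_frequently:
  fixes f :: "'a \<Rightarrow> 'b :: complete_linorder"
  assumes "\<exists>\<^sub>F x in F. c \<le> f x"
  shows "c \<le> Limsup F f"
  using assms Limsup_lessD[of F f c] by (auto simp: frequently_def not_le[symmetric])

lemma frequently_prime: "\<exists>\<^sub>F p :: nat in sequentially. prime p"
  unfolding frequently_sequentially by (meson bigger_prime less_imp_le)

text \<open>If \<open>u < t\<close>, then \<open>u\<close> is some finite \<open>k\<close> and the
  threshold \<open>Suc k\<close> is violated. Finite and infinite \<open>t\<close> are thus treated
  alike.\<close>

lemma enat_le_of_finite_le:
  fixes t u :: enat
  assumes "\<And>k. enat (Suc k) \<le> t \<Longrightarrow> enat (Suc k) \<le> u"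
  shows "t \<le> u"
proof (rule ccontr)
  assume "\<not> t \<le> u"
  then have "u < t" by simp
  then obtain k where k: "u = enat k" by (cases u) auto
  with \<open>u < t\<close> have "enat (Suc k) \<le> t" by (metis Suc_ile_eq)
  then show False using assms k by fastforce
qed

section \<open>Pairs that occur\<close>

text \<open>A representation is determined by its entry at index 2, so \<open>n > 0\<close> has as
  many as there are \<open>k < t\<close> with \<open>2 ^ k\<close> dividing \<open>n\<close>. Odd
  numbers give 1, and multiples of high powers of 2 approach or attain \<open>t\<close>.\<close>

lemma limit_pairs_one:
  assumes h: "h \<ge> 2" and t: "1 \<le> t"
  shows "(1, t) \<in> limit_pairs h"
proof -
  define D where "D = {(2::nat) ^ k | k. enat k < t}"
  define B where "B i = (if i = 1 then {1..} else if i = 2 then D else {1::nat})" for i :: nat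
  have D0: "d > 0" if "d \<in> D" for d using that by (auto simp: D_def)
  have I: "{1..h} = insert 1 (insert 2 {3..h})" using h by auto
  have prod_I: "(\<Prod>i\<in>{1..h}. f i) = f 1 * (f 2 * (\<Prod>i\<in>{3..h}. f i))" for f :: "nat \<Rightarrow> nat"
    unfolding I by simp
  have count: "rep_count h B n = card {d\<in>D. d dvd n}" if n: "n > 0" for n
  proof -
    \<comment> \<open>The inverse of \<open>b \<mapsto> b 2\<close>: the complementary divisor goes
      to index 1.\<close>
    define e where "e d = (\<lambda>i\<in>{1..h}. if i = 1 then n div d else if i = 2 then d else 1)" for d
    have reps_n: "b 2 \<in> D \<and> b 1 * b 2 = n \<and> (\<forall>i\<in>{3..h}. b i = 1) \<and> b \<in> extensional {1..h}"
      if "b \<in> reps h B n" for b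
    proof -
      have b: "b \<in> Pi\<^sub>E {1..h} B" "(\<Prod>i\<in>{1..h}. b i) = n" using that by (simp_all add: reps_def)
      have "b 2 \<in> B 2" by (rule PiE_mem[OF b(1)]) (use h in simp)
      moreover have ones: "b i = 1" if "i \<in> {3..h}" for i
        using PiE_mem[OF b(1), of i] that by (simp add: B_def)
      moreover have "b 1 * b 2 = n" using b(2) ones unfolding prod_I by simp
      ultimately show ?thesis using b(1) by (simp add: B_def PiE_def)
    qed
    have "bij_betw (\<lambda>b. b 2) (reps h B n) {d\<in>D. d dvd n}"
    proof (rule bij_betwI[where g = e])
      show "(\<lambda>b. b 2) \<in> reps h B n \<rightarrow> {d\<in>D. d dvd n}"
        using reps_n by fastforce
      show "e \<in> {d\<in>D. d dvd n} \<rightarrow> reps h B n"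
      proof
        fix d assume d: "d \<in> {d\<in>D. d dvd n}"
        then have "n div d > 0" using n by (auto elim!: dvdE)
        then have "e d \<in> Pi\<^sub>E {1..h} B" using d by (auto simp: e_def B_def)
        moreover have "(\<Prod>i\<in>{1..h}. e d i) = n"
          unfolding prod_I using d h by (simp add: e_def)
        ultimately show "e d \<in> reps h B n" by (simp add: reps_def)
      qed
      show "e (b 2) = b" if b: "b \<in> reps h B n" for b
      proof
        fix i
        have "n div b 2 = b 1" using reps_n[OF b] n by auto
        then show "e (b 2) i = b i"
          using reps_n[OF b] by (cases "i \<in> {1..h}") (auto simp: e_def extensional_def)
      qed
      show "e d 2 = d" for d using h by (simp add: e_def)
    qed
    then show ?thesis by (simp add: rep_count_eq_card_reps bij_betw_same_card)
  qed
  have "1 \<in> D" using t by (auto simp: D_def intro!: exI[of _ 0] simp: one_enat_def Suc_ile_eq zero_enat_def)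
  have ge1: "1 \<le> rep_count h B n" if n: "n > 0" for n
    using \<open>1 \<in> D\<close> n by (auto simp: count[OF n] Suc_le_eq card_gt_0_iff)
  have odd1: "rep_count h B n = 1" if n: "odd n" for n
  proof -
    have "{d\<in>D. d dvd n} = {1}"
      using \<open>1 \<in> D\<close> n by (auto simp: D_def)
    then show ?thesis using n by (simp add: count odd_pos)
  qed
  have le_t: "enat (rep_count h B n) \<le> t" if n: "n > 0" for n
  proof (cases t)
    case (enat k)
    have "{d\<in>D. d dvd n} \<subseteq> (\<lambda>j. 2 ^ j) ` {..<k}" by (auto simp: D_def enat)
    then have "card {d\<in>D. d dvd n} \<le> k" by (metis card_lessThan finite_lessThan surj_card_le)
    then show ?thesis using enat n by (simp add: count)
  qed auto
  \<comment> \<open>The exponents 0 to \<open>k\<close> give \<open>Suc k\<close> divisors. The free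
    cofactor \<open>m\<close> makes such numbers arbitrarily large.\<close>
  have ge_k: "Suc k \<le> rep_count h B (2 ^ k * m)" if k: "enat (Suc k) \<le> t" and m: "m > 0" for k m
  proof -
    have "(\<lambda>j. 2 ^ j) ` {..k} \<subseteq> {d\<in>D. d dvd 2 ^ k * m}"
    proof -
      have "enat j < t" if "j \<le> k" for j
        using k that by (metis Suc_ile_eq enat_ord_simps(1) order_le_less_trans)
      then show ?thesis by (auto simp: D_def intro: dvd_mult2 le_imp_power_dvd)
    qed
    then have "card ((\<lambda>j. (2::nat) ^ j) ` {..k}) \<le> rep_count h B (2 ^ k * m)"
      using m by (subst count) (auto intro!: card_mono)
    moreover have "card ((\<lambda>j. (2::nat) ^ j) ` {..k}) = Suc k"
      by (subst card_image) (auto simp: inj_on_def)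
    ultimately show ?thesis by simp
  qed
  let ?f = "\<lambda>n. enat (rep_count h B n)"
  have ev1: "\<forall>\<^sub>F n in sequentially. 1 \<le> rep_count h B n"
    using eventually_gt_at_top[of 0] by eventually_elim (rule ge1)
  have "asymptotic_multiplicative_system h B"
    using ev1 D0 by (force simp: asymptotic_multiplicative_system_def B_def)
  moreover have "liminf ?f = 1"
  proof (rule antisym)
    have "\<exists>\<^sub>F n :: nat in sequentially. odd n"
      unfolding frequently_sequentially by (metis even_Suc le_Suc_eq le_refl)
    then show "liminf ?f \<le> 1"
      by (intro Liminf_le_frequently) (auto elim!: frequently_elim1 simp: odd1 one_enat_def)
    show "1 \<le> liminf ?f"
      using ev1 by (intro Liminf_bounded) (auto simp: one_enat_def)
  qed
  moreover have "limsup ?f = t"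
  proof (rule antisym)
    show "limsup ?f \<le> t"
      by (intro Limsup_bounded eventually_mono[OF eventually_gt_at_top[of 0]] le_t)
    show "t \<le> limsup ?f"
    proof (rule enat_le_of_finite_le)
      fix k assume k: "enat (Suc k) \<le> t"
      have "\<exists>n\<ge>m. enat (Suc k) \<le> ?f n" for m
        using ge_k[OF k, of "Suc m"] by (intro exI[of _ "2 ^ k * Suc m"]) (simp add: trans_le_add2)
      then show "enat (Suc k) \<le> limsup ?f"
        by (intro Limsup_ge_frequently) (simp add: frequently_sequentially)
    qed
  qed
  ultimately show ?thesis unfolding limit_pairs_def by force
qed

text \<open>Placing \<open>n\<close> at each of the first \<open>s\<close> indices gives
  \<open>s\<close> representations, and primes have no others. Since \<open>s \<ge> 2\<close>, the
  limit superior is infinite by \<open>rep_count_unbounded\<close>.\<close>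

lemma limit_pairs_infinity:
  assumes s: "2 \<le> s" "s \<le> h"
  shows "(enat s, \<infinity>) \<in> limit_pairs h"
proof -
  define B where "B i = (if i \<le> s then {1..} else {1::nat})" for i :: nat
  \<comment> \<open>For \<open>n = 1\<close> the trivial factorizations would all coincide, hence
    the bound \<open>n \<ge> 2\<close>.\<close>
  have ge: "s \<le> rep_count h B n" if n: "n \<ge> 2" for n
  proof -
    have "inj_on (single h n) {1..s}"
    proof (rule inj_onI)
      fix i j assume "i \<in> {1..s}" "j \<in> {1..s}" "single h n i = single h n j"
      then have "single h n i i = single h n j i" "i \<in> {1..h}" using s by auto
      then show "i = j" using n by (auto simp: single_def split: if_splits)
    qed
    moreover have "single h n ` {1..s} \<subseteq> reps h B n"
    proof clarify
      fix i assume "i \<in> {1..s}"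
      then show "single h n i \<in> reps h B n"
        using s n prod_single[of i h n] by (auto simp: reps_def B_def single_def)
    qed
    ultimately have "card {1..s} \<le> card (reps h B n)"
      using n by (intro card_inj_on_le[of "single h n"] finite_reps) auto
    then show ?thesis by (simp add: rep_count_eq_card_reps)
  qed
  have prime: "rep_count h B p \<le> s" if p: "prime p" for p
  proof -
    have "{i\<in>{1..h}. p \<in> B i} \<subseteq> {1..s}"
      using p by (auto simp: B_def split: if_splits)
    then have "card {i\<in>{1..h}. p \<in> B i} \<le> s"
      by (metis One_nat_def card_atLeastAtMost card_mono diff_Suc_1 finite_atLeastAtMost)
    then show ?thesis using rep_count_prime_le[OF p, of h B] by simp
  qed
  have unbounded: "\<exists>n\<ge>m. k < rep_count h B n" for k m
  proof -
    \<comment> \<open>Starting at \<open>max 2 m\<close> makes the number found lie beyond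
      \<open>m\<close> as well.\<close>
    have "\<forall>n\<ge>max 2 m. rep_count h B n \<ge> 2" using ge s by (meson max.boundedE order_trans)
    from rep_count_unbounded[OF this, of k] show ?thesis by auto
  qed
  let ?f = "\<lambda>n. enat (rep_count h B n)"
  have ev: "\<forall>\<^sub>F n in sequentially. s \<le> rep_count h B n"
    using eventually_ge_at_top[of 2] by eventually_elim (rule ge)
  have "asymptotic_multiplicative_system h B"
    using ev s by (auto simp: asymptotic_multiplicative_system_def B_def elim: eventually_mono)
  moreover have "liminf ?f = enat s"
  proof (rule antisym)
    show "liminf ?f \<le> enat s"
      using frequently_prime by (intro Liminf_le_frequently) (auto elim!: frequently_elim1 simp: prime)
    show "enat s \<le> liminf ?f"
      using ev by (intro Liminf_bounded) simp
  qed
  moreover have "limsup ?f = \<infinity>"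
  proof -
    have "\<infinity> \<le> limsup ?f"
    proof (rule enat_le_of_finite_le)
      fix k
      show "enat (Suc k) \<le> limsup ?f"
        using unbounded by (intro Limsup_ge_frequently) (simp add: frequently_sequentially Suc_le_eq)
    qed
    then show ?thesis by simp
  qed
  ultimately show ?thesis unfolding limit_pairs_def by force
qed

section \<open>Necessary conditions on a limit pair\<close>

text \<open>Primes have at most \<open>h\<close> representations, which bounds \<open>s\<close>. If
  \<open>s \<ge> 2\<close> and \<open>t\<close> were finite, the counts would eventually lie between
  2 and a constant, against \<open>rep_count_unbounded\<close>. The inequality
  \<open>s \<le> t\<close> excludes \<open>t = 0\<close> when \<open>s = 1\<close>.\<close>

lemma limit_pairs_cases:
  assumes "(s, t) \<in> limit_pairs h"
  shows "1 \<le> s \<and> s \<le> enat h \<and> s \<le> t \<and> (s = 1 \<or> t = \<infinity>)"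
proof -
  obtain B where B: "asymptotic_multiplicative_system h B"
    and s: "s = liminf (\<lambda>n. enat (rep_count h B n))"
    and t: "t = limsup (\<lambda>n. enat (rep_count h B n))"
    using assms by (auto simp: limit_pairs_def)
  have "\<forall>\<^sub>F n in sequentially. 1 \<le> rep_count h B n"
    using B unfolding asymptotic_multiplicative_system_def by blast
  then have s1: "1 \<le> s" unfolding s
    by (intro Liminf_bounded) (auto simp: one_enat_def)
  have "rep_count h B p \<le> h" if "prime p" for p
  proof -
    have "card {i\<in>{1..h}. p \<in> B i} \<le> card {1..h}" by (intro card_mono) auto
    then show ?thesis using rep_count_prime_le[OF that, of h B] by simp
  qed
  then have sh: "s \<le> enat h" unfolding s
    using frequently_prime by (intro Liminf_le_frequently) (auto elim!: frequently_elim1)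
  have "t = \<infinity>" if "s \<noteq> 1"
  proof (rule ccontr)
    assume "t \<noteq> \<infinity>"
    then obtain k where k: "t = enat k" by auto
    then have "\<forall>\<^sub>F n in sequentially. enat (rep_count h B n) < enat (Suc k)"
      by (intro Limsup_lessD) (simp add: t)
    moreover have "1 < s" using s1 that by simp
    then have "\<forall>\<^sub>F n in sequentially. 1 < enat (rep_count h B n)"
      unfolding s by (rule less_LiminfD)
    ultimately have "\<forall>\<^sub>F n in sequentially. 2 \<le> rep_count h B n \<and> rep_count h B n \<le> k"
      by eventually_elim (auto simp: one_enat_def)
    then obtain N where N: "\<forall>n\<ge>N. 2 \<le> rep_count h B n \<and> rep_count h B n \<le> k"
      by (auto simp: eventually_sequentially)
    then have "\<exists>n\<ge>N. k < rep_count h B n" by (intro rep_count_unbounded) auto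
    then show False using N by fastforce
  qed
  moreover have "s \<le> t" unfolding s t by (rule Liminf_le_Limsup) simp
  ultimately show ?thesis using s1 sh by blast
qed

theorem theorem9:
  fixes h :: nat
  assumes "h \<ge> 2"
  shows "limit_pairs h =
    {(1, t) | t. t \<in> enat ` {1..} \<union> {\<infinity>}} \<union> {(enat s, \<infinity>) | s. s \<in> {2..h}}"
proof (rule set_eqI, rule iffI)
  fix x assume x: "x \<in> limit_pairs h"
  obtain s t where st: "x = (s, t)" by (cases x)
  with x have *: "1 \<le> s" "s \<le> enat h" "s \<le> t" "s = 1 \<or> t = \<infinity>"
    using limit_pairs_cases by blast+
  obtain k where k: "s = enat k" using *(2) by (cases s) auto
  show "x \<in> {(1, t) | t. t \<in> enat ` {1..} \<union> {\<infinity>}} \<union> {(enat s, \<infinity>) | s. s \<in> {2..h}}"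
  proof (cases "s = 1")
    case True
    then have "t \<in> enat ` {1..} \<union> {\<infinity>}" using *(3) by (cases t) (auto simp: one_enat_def)
    then show ?thesis using True st by auto
  next
    case False
    then have "k \<in> {2..h}" using * k by (auto simp: one_enat_def)
    then show ?thesis using False * st k by auto
  qed
next
  fix x assume "x \<in> {(1, t) | t. t \<in> enat ` {1..} \<union> {\<infinity>}} \<union> {(enat s, \<infinity>) | s. s \<in> {2..h}}"
  then consider t where "x = (1, t)" "1 \<le> t" | s where "x = (enat s, \<infinity>)" "2 \<le> s" "s \<le> h"
    by (auto simp: one_enat_def)
  then show "x \<in> limit_pairs h"
    using limit_pairs_one[OF assms] limit_pairs_infinity by cases auto
qed

end
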